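(* Let $\|\cdot\|$ be a norm on $\mathbb{R}^n$ with compatible weak pairing $[\![\cdot,\cdot]\!]$ satisfying Deimling's inequality. Then for all $A\in\mathbb{R}^{n\times n}$, $$\mu(A)=\sup_{\|x\|=1}[\![Ax,x]\!]=\sup_{x\neq 0_n}\frac{[\![Ax,x]\!]}{\|x\|^2}.$$
   Context: A weak pairing on $\mathbb{R}^n$ is a map $[\![\cdot,\cdot]\!]:\mathbb{R}^n\times\mathbb{R}^n\to\mathbb{R}$ such that: (1) $[\![x_1+x_2,y]\!]\le[\![x_1,y]\!]+[\![x_2,y]\!]$ for all $x_1,x_2,y$, and it is continuous in its first argument; (2) $[\![\alpha x,y]\!]=[\![x,\alpha y]\!]=\alpha[\![x,y]\!]$ for all $x,y$ and all $\alpha\ge 0$, and $[\![-x,-y]\!]=[\![x,y]\!]$; (3) $[\![x,x]\!]>0$ for all $x\ne 0_n$; (4) $|[\![x,y]\!]|\le[\![x,x]\!]^{1/2}[\![y,y]\!]^{1/2}$ for all $x,y$. It is compatible with the norm $\|\cdot\|$ if $[\![x,x]\!]=\|x\|^2$ for all $x$. It satisfies Deimling's inequality if $[\![x,y]\!]\le\|y\|\lim_{h\to0^+}\frac{\|y+hx\|-\|y\|}{h}$ for all $x,y\in\mathbb{R}^n$. The logarithmic norm of $A\in\mathbb{R}^{n\times n}$ with respect to $\|\cdot\|$ is $\mu(A)=\lim_{h\to0^+}\frac{\|I_n+hA\|-1}{h}$, where $\|\cdot\|$ on matrices is the induced operator norm. $0_n$ is the zero vector of $\mathbb{R}^n$.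 *)

theory Defs
  imports "HOL-Analysis.Analysis"
begin

text \<open>
  An arbitrary norm on \<open>real ^ 'n\<close> is a function \<open>\<nu>\<close>, since the overloaded constant
  \<^const>\<open>norm\<close> is always the Euclidean one there.
\<close>

definition is_norm :: "('a::real_vector \<Rightarrow> real) \<Rightarrow> bool" where
  "is_norm \<nu> \<longleftrightarrow>
     (\<forall>x. 0 \<le> \<nu> x) \<and>
     (\<forall>x. \<nu> x = 0 \<longleftrightarrow> x = 0) \<and>
     (\<forall>c x. \<nu> (c *\<^sub>R x) = \<bar>c\<bar> * \<nu> x) \<and>
     (\<forall>x y. \<nu> (x + y) \<le> \<nu> x + \<nu> y)"

definition weak_pairing :: "(real ^ 'n \<Rightarrow> real ^ 'n \<Rightarrow> real) \<Rightarrow> bool" where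
  "weak_pairing W \<longleftrightarrow>
     (\<forall>x1 x2 y. W (x1 + x2) y \<le> W x1 y + W x2 y) \<and>
     (\<forall>y. continuous_on UNIV (\<lambda>x. W x y)) \<and>
     (\<forall>\<alpha> x y. 0 \<le> \<alpha> \<longrightarrow> W (\<alpha> *\<^sub>R x) y = \<alpha> * W x y \<and> W x (\<alpha> *\<^sub>R y) = \<alpha> * W x y) \<and>
     (\<forall>x y. W (- x) (- y) = W x y) \<and>
     (\<forall>x. x \<noteq> 0 \<longrightarrow> 0 < W x x) \<and>
     (\<forall>x y. \<bar>W x y\<bar> \<le> sqrt (W x x) * sqrt (W y y))"

definition compatible :: "(real ^ 'n \<Rightarrow> real ^ 'n \<Rightarrow> real) \<Rightarrow> (real ^ 'n \<Rightarrow> real) \<Rightarrow> bool" where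
  "compatible W \<nu> \<longleftrightarrow> (\<forall>x. W x x = (\<nu> x)\<^sup>2)"

definition deimling :: "(real ^ 'n \<Rightarrow> real ^ 'n \<Rightarrow> real) \<Rightarrow> (real ^ 'n \<Rightarrow> real) \<Rightarrow> bool" where
  "deimling W \<nu> \<longleftrightarrow>
     (\<forall>x y. W x y \<le> \<nu> y * Lim (at_right 0) (\<lambda>h. (\<nu> (y + h *\<^sub>R x) - \<nu> y) / h))"

definition induced_norm :: "(real ^ 'n \<Rightarrow> real) \<Rightarrow> real ^ 'n ^ 'n \<Rightarrow> real" where
  "induced_norm \<nu> A = (SUP x\<in>{x. \<nu> x = 1}. \<nu> (A *v x))"

definition log_norm :: "(real ^ 'n \<Rightarrow> real) \<Rightarrow> real ^ 'n ^ 'n \<Rightarrow> real" where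
  "log_norm \<nu> A = Lim (at_right 0) (\<lambda>h. (induced_norm \<nu> (mat 1 + h *\<^sub>R A) - 1) / h)"

text \<open>
  \<^const>\<open>Lim\<close> and the supremum on \<^typ>\<open>real\<close> are unspecified when the limit does not exist or the
  set is empty or unbounded. The facts below show that this never happens here.
\<close>

lemma is_normD:
  assumes "is_norm \<nu>"
  shows "0 \<le> \<nu> x" "\<nu> x = 0 \<longleftrightarrow> x = 0" "\<nu> (c *\<^sub>R x) = \<bar>c\<bar> * \<nu> x" "\<nu> (x + y) \<le> \<nu> x + \<nu> y"
  using assms unfolding is_norm_def by blast+

lemma one_sided_derivative_exists:
  fixes p :: "'a::real_vector \<Rightarrow> real"
  assumes hom: "\<And>c x. p (c *\<^sub>R x) = \<bar>c\<bar> * p x"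
    and tri: "\<And>x y. p (x + y) \<le> p x + p y"
  shows "\<exists>L. ((\<lambda>h. (p (y + h *\<^sub>R x) - p y) / h) \<longlongrightarrow> L) (at_right 0)"
proof -
  define g where "g h = (p (y + h *\<^sub>R x) - p y) / h" for h
  have mono: "g s \<le> g t" if "0 < s" "s \<le> t" for s t
  proof -
    have "y + s *\<^sub>R x = (1 - s/t) *\<^sub>R y + (s/t) *\<^sub>R (y + t *\<^sub>R x)"
      using that by (simp add: algebra_simps)
    then have "p (y + s *\<^sub>R x) \<le> \<bar>1 - s/t\<bar> * p y + \<bar>s/t\<bar> * p (y + t *\<^sub>R x)"
      using tri[of "(1 - s/t) *\<^sub>R y" "(s/t) *\<^sub>R (y + t *\<^sub>R x)"] by (simp add: hom del: scaleR_add_right)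
    also have "\<dots> = p y + (s/t) * (p (y + t *\<^sub>R x) - p y)"
      using that by (simp add: algebra_simps)
    finally show ?thesis
      using that unfolding g_def by (simp add: field_simps)
  qed
  have lower: "- p x \<le> g h" if "0 < h" for h
  proof -
    have "p y \<le> p (y + h *\<^sub>R x) + h * p x"
      using tri[of "y + h *\<^sub>R x" "(- h) *\<^sub>R x"] hom[of "- h" x] that by simp
    then show ?thesis
      using that unfolding g_def by (simp add: field_simps)
  qed
  define L where "L = (INF h\<in>{0<..}. g h)"
  have bdd: "bdd_below (g ` {0<..})"
    using lower by (auto intro!: bdd_belowI2)
  have "(g \<longlongrightarrow> L) (at_right 0)"
  proof (rule order_tendstoI)
    fix a assume "a < L"
    moreover have "L \<le> g h" if "0 < h" for h
      unfolding L_def by (rule cINF_lower[OF bdd]) (use that in auto)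
    ultimately show "\<forall>\<^sub>F h in at_right 0. a < g h"
      unfolding eventually_at_right_field by (meson less_le_trans zero_less_one)
  next
    fix a assume "L < a"
    then obtain t where "0 < t" "g t < a"
      unfolding L_def using bdd by (subst (asm) cINF_less_iff) auto
    then show "\<forall>\<^sub>F h in at_right 0. g h < a"
      unfolding eventually_at_right_field by (meson less_imp_le mono le_less_trans)
  qed
  then show ?thesis unfolding g_def by blast
qed

lemma tendsto_Lim_at_right_0:
  fixes f :: "real \<Rightarrow> real"
  assumes "\<exists>L. (f \<longlongrightarrow> L) (at_right 0)"
  shows "(f \<longlongrightarrow> Lim (at_right 0) f) (at_right 0)"
proof -
  obtain L where L: "(f \<longlongrightarrow> L) (at_right 0)"
    using assms by blast
  then have "Lim (at_right 0) f = L"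
    by (intro tendsto_Lim) simp_all
  then show ?thesis using L by simp
qed

lemma deimling_limit:
  assumes "is_norm \<nu>"
  shows "((\<lambda>h. (\<nu> (y + h *\<^sub>R x) - \<nu> y) / h) \<longlongrightarrow>
           Lim (at_right 0) (\<lambda>h. (\<nu> (y + h *\<^sub>R x) - \<nu> y) / h)) (at_right 0)"
  by (intro tendsto_Lim_at_right_0 one_sided_derivative_exists is_normD(3,4) assms)

lemma unit_sphere_nonempty:
  fixes \<nu> :: "real ^ 'n \<Rightarrow> real"
  assumes "is_norm \<nu>"
  shows "{x. \<nu> x = 1} \<noteq> {}"
proof -
  have "\<nu> (axis undefined 1) > 0"
    using is_normD(1,2)[OF assms, of "axis undefined 1"] by (simp add: order_less_le axis_eq_0_iff)
  then have "\<nu> ((1 / \<nu> (axis undefined 1)) *\<^sub>R axis undefined 1) = 1"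
    by (simp add: is_normD(3)[OF assms])
  then show ?thesis by blast
qed

lemma is_norm_le_norm:
  fixes \<nu> :: "real ^ 'n \<Rightarrow> real"
  assumes "is_norm \<nu>"
  shows "\<exists>C>0. \<forall>x. \<nu> x \<le> C * norm x"
proof -
  let ?C = "(\<Sum>b\<in>Basis. \<nu> b) + 1"
  have sum: "\<nu> (sum f B) \<le> (\<Sum>b\<in>B. \<nu> (f b))" if "finite B" for f and B :: "(real ^ 'n) set"
    using that
  proof (induction B)
    case empty
    then show ?case using is_normD(2)[OF assms, of 0] by simp
  next
    case (insert b B)
    then show ?case using is_normD(4)[OF assms, of "f b" "sum f B"] by simp
  qed
  have "\<nu> x \<le> ?C * norm x" for x
  proof -
    have "\<nu> x = \<nu> (\<Sum>b\<in>Basis. (x \<bullet> b) *\<^sub>R b)"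
      by (simp only: euclidean_representation)
    also have "\<dots> \<le> (\<Sum>b\<in>Basis. \<bar>x \<bullet> b\<bar> * \<nu> b)"
      using sum[OF finite_Basis, of "\<lambda>b. (x \<bullet> b) *\<^sub>R b"] by (simp only: is_normD(3)[OF assms])
    also have "\<dots> \<le> (\<Sum>b\<in>Basis. norm x * \<nu> b)"
      by (intro sum_mono mult_right_mono Basis_le_norm is_normD(1)[OF assms])
    also have "\<dots> \<le> ?C * norm x"
      by (simp add: sum_distrib_left algebra_simps)
    finally show ?thesis .
  qed
  moreover have "?C > 0"
    using sum_nonneg[of Basis \<nu>] is_normD(1)[OF assms] by (smt (verit))
  ultimately show ?thesis by blast
qed

lemma norm_le_is_norm:
  fixes \<nu> :: "real ^ 'n \<Rightarrow> real"
  assumes "is_norm \<nu>"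
  shows "\<exists>c>0. \<forall>x. c * norm x \<le> \<nu> x"
proof -
  obtain C where C: "C > 0" "\<And>x. \<nu> x \<le> C * norm x"
    using is_norm_le_norm[OF assms] by blast
  have diff: "\<bar>\<nu> x - \<nu> y\<bar> \<le> C * norm (x - y)" for x y
    using is_normD(4)[OF assms, of y "x - y"] is_normD(4)[OF assms, of x "y - x"]
      C(2)[of "x - y"] C(2)[of "y - x"] by (simp add: norm_minus_commute)
  have "C-lipschitz_on UNIV \<nu>"
    using diff C(1) by (intro lipschitz_onI) (auto simp: dist_norm)
  then have "continuous_on (sphere 0 1) \<nu>"
    by (meson lipschitz_on_continuous_on lipschitz_on_subset subset_UNIV)
  moreover have "sphere 0 1 \<noteq> ({} :: (real ^ 'n) set)" by simp
  ultimately obtain z where z: "z \<in> sphere 0 1" "\<And>x. x \<in> sphere 0 1 \<Longrightarrow> \<nu> z \<le> \<nu> x"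
    using continuous_attains_inf[OF compact_sphere] by blast
  have "\<nu> z * norm x \<le> \<nu> x" for x
  proof (cases "x = 0")
    case True
    then show ?thesis using is_normD(1)[OF assms] by simp
  next
    case False
    then have "\<nu> z \<le> \<nu> ((1 / norm x) *\<^sub>R x)" by (intro z(2)) simp
    then show ?thesis using False by (simp add: is_normD(3)[OF assms] field_simps)
  qed
  moreover have "\<nu> z > 0"
    using z(1) is_normD(1,2)[OF assms, of z] by (auto simp: order_less_le)
  ultimately show ?thesis by blast
qed

lemma bdd_above_induced_norm:
  fixes \<nu> :: "real ^ 'n \<Rightarrow> real"
  assumes "is_norm \<nu>"
  shows "bdd_above ((\<lambda>x. \<nu> (A *v x)) ` {x. \<nu> x = 1})"
proof -
  obtain C where C: "C > 0" "\<And>x. \<nu> x \<le> C * norm x"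
    using is_norm_le_norm[OF assms] by blast
  obtain c where c: "c > 0" "\<And>x. c * norm x \<le> \<nu> x"
    using norm_le_is_norm[OF assms] by blast
  obtain K where K: "K > 0" "\<And>x. norm (A *v x) \<le> norm x * K"
    using bounded_linear.pos_bounded[OF matrix_vector_mul_bounded_linear[of A]] by blast
  show ?thesis
  proof (rule bdd_aboveI2)
    fix x assume "x \<in> {x. \<nu> x = 1}"
    then have "norm x \<le> 1 / c"
      using c(2)[of x] c(1) by (simp add: field_simps)
    then have "norm (A *v x) \<le> 1 / c * K"
      using K(2)[of x] mult_right_mono[of "norm x" "1 / c" K] K(1) by linarith
    then show "\<nu> (A *v x) \<le> C * (1 / c * K)"
      using C(2)[of "A *v x"] mult_left_mono[of "norm (A *v x)" "1 / c * K" C] C(1) by linarith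
  qed
qed

lemma induced_norm_scaleR:
  fixes \<nu> :: "real ^ 'n \<Rightarrow> real"
  assumes "is_norm \<nu>"
  shows "induced_norm \<nu> (c *\<^sub>R A) = \<bar>c\<bar> * induced_norm \<nu> A"
proof -
  have le: "induced_norm \<nu> (c *\<^sub>R A) \<le> \<bar>c\<bar> * induced_norm \<nu> A" for c and A :: "real ^ 'n ^ 'n"
    unfolding induced_norm_def
  proof (rule cSUP_least[OF unit_sphere_nonempty[OF assms]])
    fix x assume "x \<in> {x. \<nu> x = 1}"
    then show "\<nu> ((c *\<^sub>R A) *v x) \<le> \<bar>c\<bar> * (SUP x\<in>{x. \<nu> x = 1}. \<nu> (A *v x))"
      using bdd_above_induced_norm[OF assms]
      by (auto simp: scaleR_matrix_vector_assoc[symmetric] is_normD(3)[OF assms]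
          intro!: mult_left_mono cSUP_upper)
  qed
  show ?thesis
  proof (cases "c = 0")
    case True
    have "induced_norm \<nu> 0 = 0"
      unfolding induced_norm_def using unit_sphere_nonempty[OF assms] is_normD(2)[OF assms, of 0]
      by simp
    then show ?thesis using True by simp
  next
    case False
    then show ?thesis
      using le[of c A] le[of "inverse c" "c *\<^sub>R A"] by (simp add: field_simps abs_inverse)
  qed
qed

lemma induced_norm_triangle:
  fixes \<nu> :: "real ^ 'n \<Rightarrow> real"
  assumes "is_norm \<nu>"
  shows "induced_norm \<nu> (A + B) \<le> induced_norm \<nu> A + induced_norm \<nu> B"
  unfolding induced_norm_def
proof (rule cSUP_least[OF unit_sphere_nonempty[OF assms]])
  fix x assume x: "x \<in> {x. \<nu> x = 1}"
  have "\<nu> ((A + B) *v x) \<le> \<nu> (A *v x) + \<nu> (B *v x)"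
    by (simp add: matrix_vector_mult_add_rdistrib is_normD(4)[OF assms])
  also have "\<dots> \<le> (SUP x\<in>{x. \<nu> x = 1}. \<nu> (A *v x)) + (SUP x\<in>{x. \<nu> x = 1}. \<nu> (B *v x))"
    by (intro add_mono cSUP_upper[OF x] bdd_above_induced_norm assms)
  finally show "\<nu> ((A + B) *v x) \<le>
      (SUP x\<in>{x. \<nu> x = 1}. \<nu> (A *v x)) + (SUP x\<in>{x. \<nu> x = 1}. \<nu> (B *v x))" .
qed

lemma log_norm_limit:
  fixes \<nu> :: "real ^ 'n \<Rightarrow> real"
  assumes "is_norm \<nu>"
  shows "((\<lambda>h. (induced_norm \<nu> (mat 1 + h *\<^sub>R A) - 1) / h) \<longlongrightarrow> log_norm \<nu> A) (at_right 0)"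
proof -
  have "induced_norm \<nu> (mat 1) = 1"
    unfolding induced_norm_def using unit_sphere_nonempty[OF assms] by simp
  moreover have "\<exists>L. ((\<lambda>h. (induced_norm \<nu> (mat 1 + h *\<^sub>R A) - induced_norm \<nu> (mat 1)) / h) \<longlongrightarrow> L)
      (at_right 0)"
    by (intro one_sided_derivative_exists induced_norm_scaleR induced_norm_triangle assms)
  ultimately show ?thesis
    unfolding log_norm_def by (intro tendsto_Lim_at_right_0) simp
qed

lemma bdd_above_weak_pairing:
  fixes \<nu> :: "real ^ 'n \<Rightarrow> real"
  assumes "is_norm \<nu>" "weak_pairing W" "compatible W \<nu>"
  shows "bdd_above ((\<lambda>x. W (A *v x) x) ` {x. \<nu> x = 1})"
    and "bdd_above ((\<lambda>x. W (A *v x) x / (\<nu> x)\<^sup>2) ` {x. x \<noteq> 0})"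
proof -
  have W: "W x y \<le> \<nu> x * \<nu> y" for x y
  proof -
    have "\<bar>W x y\<bar> \<le> sqrt (W x x) * sqrt (W y y)"
      using assms(2) unfolding weak_pairing_def by blast
    then show ?thesis
      using assms(3) is_normD(1)[OF assms(1)] by (simp add: compatible_def)
  qed
  obtain M where M: "\<And>x. \<nu> x = 1 \<Longrightarrow> \<nu> (A *v x) \<le> M"
    using bdd_above_induced_norm[OF assms(1), of A] by (auto simp: bdd_above_def)
  show "bdd_above ((\<lambda>x. W (A *v x) x) ` {x. \<nu> x = 1})"
  proof (rule bdd_aboveI2)
    fix x assume "x \<in> {x. \<nu> x = 1}"
    then show "W (A *v x) x \<le> M"
      using W[of "A *v x" x] M[of x] by simp
  qed
  show "bdd_above ((\<lambda>x. W (A *v x) x / (\<nu> x)\<^sup>2) ` {x. x \<noteq> 0})"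
  proof (rule bdd_aboveI2)
    fix x :: "real ^ 'n" assume "x \<in> {x. x \<noteq> 0}"
    then have pos: "\<nu> x > 0"
      using is_normD(1,2)[OF assms(1), of x] by (simp add: order_less_le)
    have "\<nu> ((1 / \<nu> x) *\<^sub>R x) = 1"
      using pos by (simp add: is_normD(3)[OF assms(1)])
    from M[OF this] have "\<nu> (A *v x) \<le> M * \<nu> x"
      using pos by (simp add: matrix_vector_mult_scaleR is_normD(3)[OF assms(1)] field_simps)
    then have "W (A *v x) x \<le> M * \<nu> x * \<nu> x"
      using W[of "A *v x" x] pos by (meson mult_right_mono order_trans less_imp_le)
    then show "W (A *v x) x / (\<nu> x)\<^sup>2 \<le> M"
      using pos by (simp add: field_simps power2_eq_square)
  qed
qed

end

theory Submission
  imports Defs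
begin

text \<open>
  Write \<open>s\<close> for the supremum of \<open>W (A *v x) x\<close> over the unit sphere of \<open>\<nu>\<close>. The two suprema agree
  because \<open>W (A *v x) x\<close> is homogeneous of degree two in \<open>x\<close>, so each quotient is the value of the
  pairing at a normalized vector. It remains to compare \<open>s\<close> with the logarithmic norm.

  Deimling's inequality gives \<open>s \<le> log_norm \<nu> A\<close>: on the unit sphere it bounds \<open>W (A *v x) x\<close> by the
  derivative of \<open>\<nu>\<close> at \<open>x\<close> in the direction \<open>A *v x\<close>, and \<open>\<nu> (x + h *\<^sub>R (A *v x))\<close> is at most the
  induced norm of \<open>mat 1 + h *\<^sub>R A\<close> (\<open>pairing_le_log_norm\<close>).

  For the converse, subadditivity and the Cauchy-Schwarz inequality for \<open>W\<close> give Lumer's lower bound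
  \<open>(1 - h * s) * \<nu> x \<le> \<nu> (x - h *\<^sub>R (A *v x))\<close> (\<open>lumer_lower_bound\<close>). This is a statement about
  \<open>I - h A\<close>, whereas the logarithmic norm concerns \<open>I + h A\<close>; the identity
  \<open>(I - h A) (I + h A) = I - h\<^sup>2 A\<^sup>2\<close> passes from one to the other at the price of a term of second
  order in \<open>h\<close>, which disappears in the limit (\<open>log_norm_le\<close>).
\<close>

section \<open>Weak pairings and suprema\<close>

lemma weak_pairing_scaleR:
  assumes "weak_pairing W" and "0 \<le> a"
  shows "W (a *\<^sub>R x) y = a * W x y" and "W x (a *\<^sub>R y) = a * W x y"
  using assms unfolding weak_pairing_def by blast+

lemma weak_pairing_Cauchy_Schwarz:
  assumes "is_norm \<nu>" and "weak_pairing W" and "compatible W \<nu>"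
  shows "W x y \<le> \<nu> x * \<nu> y"
proof -
  have "\<bar>W x y\<bar> \<le> sqrt (W x x) * sqrt (W y y)"
    using assms(2) unfolding weak_pairing_def by blast
  then show ?thesis
    using assms(3) is_normD(1)[OF assms(1)] by (simp add: compatible_def)
qed

lemma is_norm_pos:
  assumes "is_norm \<nu>" and "x \<noteq> 0"
  shows "0 < \<nu> x"
  using is_normD(1,2)[OF assms(1), of x] assms(2) by (simp add: order_less_le)

lemma pairing_quotient_eq_normalized:
  fixes A :: "real ^ 'n ^ 'n"
  assumes "is_norm \<nu>" and "weak_pairing W" and "x \<noteq> 0"
  shows "W (A *v x) x / (\<nu> x)\<^sup>2 = W (A *v ((1 / \<nu> x) *\<^sub>R x)) ((1 / \<nu> x) *\<^sub>R x)"
  using is_norm_pos[OF assms(1,3)]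
  by (simp add: matrix_vector_mult_scaleR weak_pairing_scaleR[OF assms(2)] power2_eq_square)

lemma pairing_sphere_image_eq_quotient_image:
  fixes A :: "real ^ 'n ^ 'n"
  assumes "is_norm \<nu>" and "weak_pairing W"
  shows "(\<lambda>x. W (A *v x) x) ` {x. \<nu> x = 1} = (\<lambda>x. W (A *v x) x / (\<nu> x)\<^sup>2) ` {x. x \<noteq> 0}"
proof
  show "(\<lambda>x. W (A *v x) x) ` {x. \<nu> x = 1} \<subseteq> (\<lambda>x. W (A *v x) x / (\<nu> x)\<^sup>2) ` {x. x \<noteq> 0}"
  proof clarify
    fix x assume "\<nu> x = 1"
    moreover from this have "x \<noteq> 0"
      using is_normD(2)[OF assms(1), of x] by auto
    ultimately show "W (A *v x) x \<in> (\<lambda>x. W (A *v x) x / (\<nu> x)\<^sup>2) ` {x. x \<noteq> 0}"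
      by (intro image_eqI[of _ _ x]) auto
  qed
  show "(\<lambda>x. W (A *v x) x / (\<nu> x)\<^sup>2) ` {x. x \<noteq> 0} \<subseteq> (\<lambda>x. W (A *v x) x) ` {x. \<nu> x = 1}"
  proof clarify
    fix x :: "real ^ 'n" assume "x \<noteq> 0"
    then have "\<nu> ((1 / \<nu> x) *\<^sub>R x) = 1"
      using is_norm_pos[OF assms(1), of x] by (simp add: is_normD(3)[OF assms(1)])
    then show "W (A *v x) x / (\<nu> x)\<^sup>2 \<in> (\<lambda>x. W (A *v x) x) ` {x. \<nu> x = 1}"
      using pairing_quotient_eq_normalized[OF assms \<open>x \<noteq> 0\<close>, of A] by blast
  qed
qed

section \<open>The pairing is bounded by the logarithmic norm\<close>

text \<open>
  The difference quotients of \<open>\<nu>\<close> at \<open>x\<close> and of the induced norm at the identity are compared for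
  each \<open>h > 0\<close>, and the inequality survives the limit.
\<close>

lemma pairing_le_log_norm:
  fixes A :: "real ^ 'n ^ 'n"
  assumes "is_norm \<nu>" and "deimling W \<nu>" and "\<nu> x = 1"
  shows "W (A *v x) x \<le> log_norm \<nu> A"
proof -
  have "W (A *v x) x \<le> \<nu> x * Lim (at_right 0) (\<lambda>h. (\<nu> (x + h *\<^sub>R (A *v x)) - \<nu> x) / h)"
    using assms(2) unfolding deimling_def by blast
  also have "\<dots> = Lim (at_right 0) (\<lambda>h. (\<nu> (x + h *\<^sub>R (A *v x)) - \<nu> x) / h)"
    by (simp only: assms(3) mult_1)
  also have "\<dots> \<le> log_norm \<nu> A"
  proof (rule tendsto_le[OF _ log_norm_limit[OF assms(1)] deimling_limit[OF assms(1)]])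
    have "(\<nu> (x + h *\<^sub>R (A *v x)) - \<nu> x) / h \<le> (induced_norm \<nu> (mat 1 + h *\<^sub>R A) - 1) / h"
      if "0 < h" for h
    proof -
      have "\<nu> ((mat 1 + h *\<^sub>R A) *v x) \<le> induced_norm \<nu> (mat 1 + h *\<^sub>R A)"
        unfolding induced_norm_def
        by (intro cSUP_upper bdd_above_induced_norm assms(1)) (use assms(3) in simp)
      then show ?thesis
        using that assms(3)
        by (simp add: matrix_vector_mult_add_rdistrib scaleR_matrix_vector_assoc[symmetric]
            divide_right_mono)
    qed
    then show "\<forall>\<^sub>F h in at_right 0. (\<nu> (x + h *\<^sub>R (A *v x)) - \<nu> x) / h
        \<le> (induced_norm \<nu> (mat 1 + h *\<^sub>R A) - 1) / h"
      unfolding eventually_at_right_field by (meson zero_less_one)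
  qed simp
  finally show ?thesis .
qed

section \<open>The logarithmic norm is bounded by the pairing\<close>

text \<open>
  Subadditivity bounds \<open>W x x\<close> by \<open>W (x - h *\<^sub>R (A *v x)) x + h * W (A *v x) x\<close>. Here the first
  summand is at most \<open>\<nu> (x - h *\<^sub>R (A *v x)) * \<nu> x\<close>, and dividing by \<open>\<nu> x\<close> gives the claim.
\<close>

lemma lumer_lower_bound:
  fixes A :: "real ^ 'n ^ 'n"
  assumes "is_norm \<nu>" and "weak_pairing W" and "compatible W \<nu>"
    and s: "W (A *v x) x \<le> s * (\<nu> x)\<^sup>2" and "0 \<le> h"
  shows "(1 - h * s) * \<nu> x \<le> \<nu> (x - h *\<^sub>R (A *v x))"
proof (cases "x = 0")
  case True
  then show ?thesis
    using is_normD(2)[OF assms(1), of 0] by simp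
next
  case False
  let ?y = "x - h *\<^sub>R (A *v x)"
  have "(\<nu> x)\<^sup>2 = W (?y + h *\<^sub>R (A *v x)) x"
    using assms(3) by (simp add: compatible_def)
  also have "\<dots> \<le> W ?y x + W (h *\<^sub>R (A *v x)) x"
    using assms(2) unfolding weak_pairing_def by blast
  also have "\<dots> \<le> \<nu> ?y * \<nu> x + h * (s * (\<nu> x)\<^sup>2)"
    using weak_pairing_Cauchy_Schwarz[OF assms(1-3), of ?y x] s \<open>0 \<le> h\<close>
    by (simp add: weak_pairing_scaleR[OF assms(2)] add_mono mult_left_mono)
  finally have "((1 - h * s) * \<nu> x) * \<nu> x \<le> \<nu> ?y * \<nu> x"
    by (simp add: algebra_simps power2_eq_square)
  then show ?thesis
    using is_norm_pos[OF assms(1) False] by simp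
qed

text \<open>
  Applying the hypothesis to \<open>x + h *\<^sub>R (A *v x)\<close> with \<open>\<nu> x = 1\<close> bounds, for small \<open>h\<close>, the induced norm of
  \<open>mat 1 + h *\<^sub>R A\<close> by \<open>(1 + h\<^sup>2 * K) / (1 - h * s)\<close>, where \<open>K\<close> is the induced norm of \<open>A ** A\<close>. The
  difference quotient is then at most \<open>(s + h * K) / (1 - h * s)\<close>, which tends to \<open>s\<close>.
\<close>

lemma log_norm_le:
  fixes A :: "real ^ 'n ^ 'n"
  assumes "is_norm \<nu>"
    and lower: "\<And>h x. 0 \<le> h \<Longrightarrow> (1 - h * s) * \<nu> x \<le> \<nu> (x - h *\<^sub>R (A *v x))"
  shows "log_norm \<nu> A \<le> s"
proof -
  define K where "K = induced_norm \<nu> (A ** A)"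
  have quotient: "(induced_norm \<nu> (mat 1 + h *\<^sub>R A) - 1) / h \<le> (s + h * K) / (1 - h * s)"
    if "0 < h" "0 < 1 - h * s" for h
  proof -
    have "induced_norm \<nu> (mat 1 + h *\<^sub>R A) \<le> (1 + h\<^sup>2 * K) / (1 - h * s)"
      unfolding induced_norm_def
    proof (rule cSUP_least[OF unit_sphere_nonempty[OF assms(1)]])
      fix x assume x: "x \<in> {x. \<nu> x = 1}"
      let ?y = "x + h *\<^sub>R (A *v x)"
      have "(1 - h * s) * \<nu> ?y \<le> \<nu> (?y - h *\<^sub>R (A *v ?y))"
        using \<open>0 < h\<close> by (intro lower) simp
      also have "?y - h *\<^sub>R (A *v ?y) = x + (- (h\<^sup>2)) *\<^sub>R ((A ** A) *v x)"
        by (simp add: matrix_vector_right_distrib matrix_vector_mult_scaleR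
            matrix_vector_mul_assoc[symmetric] scaleR_add_right power2_eq_square)
      also have "\<nu> \<dots> \<le> \<nu> x + h\<^sup>2 * \<nu> ((A ** A) *v x)"
        using is_normD(4)[OF assms(1), of x "(- (h\<^sup>2)) *\<^sub>R ((A ** A) *v x)"]
        by (simp only: is_normD(3)[OF assms(1)]) simp
      also have "\<dots> \<le> 1 + h\<^sup>2 * K"
        unfolding K_def induced_norm_def using x
        by (intro add_mono mult_left_mono cSUP_upper[OF x] bdd_above_induced_norm assms(1)) auto
      finally show "\<nu> ((mat 1 + h *\<^sub>R A) *v x) \<le> (1 + h\<^sup>2 * K) / (1 - h * s)"
        using \<open>0 < 1 - h * s\<close>
        by (simp add: matrix_vector_mult_add_rdistrib scaleR_matrix_vector_assoc[symmetric]
            pos_le_divide_eq mult.commute)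
    qed
    also have "\<dots> = 1 + h * ((s + h * K) / (1 - h * s))"
      using that by (simp add: field_simps power2_eq_square)
    finally show ?thesis
      using \<open>0 < h\<close> by (simp add: pos_divide_le_eq mult.commute)
  qed
  have "((\<lambda>h. (s + h * K) / (1 - h * s)) \<longlongrightarrow> (s + 0 * K) / (1 - 0 * s)) (at_right 0)"
    by (intro tendsto_intros) simp
  then have limit: "((\<lambda>h. (s + h * K) / (1 - h * s)) \<longlongrightarrow> s) (at_right 0)"
    by simp
  have "((\<lambda>h. 1 - h * s) \<longlongrightarrow> 1 - 0 * s) (at_right 0)"
    by (intro tendsto_intros)
  then have "\<forall>\<^sub>F h in at_right 0. 0 < 1 - h * s"
    by (intro order_tendstoD(1)) auto
  then have "\<forall>\<^sub>F h in at_right 0.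
      (induced_norm \<nu> (mat 1 + h *\<^sub>R A) - 1) / h \<le> (s + h * K) / (1 - h * s)"
    using eventually_at_right_less[of "0 :: real"] by eventually_elim (rule quotient)
  then show ?thesis
    by (intro tendsto_le[OF _ limit log_norm_limit[OF assms(1)]]) simp_all
qed

section \<open>The logarithmic norm as a supremum of pairings\<close>

theorem theorem18:
  fixes \<nu> :: "real ^ 'n \<Rightarrow> real"
    and W :: "real ^ 'n \<Rightarrow> real ^ 'n \<Rightarrow> real"
  assumes "is_norm \<nu>"
    and "weak_pairing W"
    and "compatible W \<nu>"
    and "deimling W \<nu>"
  shows "\<forall>A :: real ^ 'n ^ 'n.
           log_norm \<nu> A = (SUP x\<in>{x. \<nu> x = 1}. W (A *v x) x) \<and>
           (SUP x\<in>{x. \<nu> x = 1}. W (A *v x) x) = (SUP x\<in>{x. x \<noteq> 0}. W (A *v x) x / (\<nu> x)\<^sup>2)"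
proof
  fix A :: "real ^ 'n ^ 'n"
  let ?s = "SUP x\<in>{x. \<nu> x = 1}. W (A *v x) x"
  have suprema: "?s = (SUP x\<in>{x. x \<noteq> 0}. W (A *v x) x / (\<nu> x)\<^sup>2)"
    using pairing_sphere_image_eq_quotient_image[OF assms(1,2), of A] by simp
  have "W (A *v x) x \<le> ?s * (\<nu> x)\<^sup>2" for x
  proof (cases "x = 0")
    case True
    then show ?thesis
      using weak_pairing_scaleR(1)[OF assms(2), of 0 0 x] is_normD(2)[OF assms(1), of x] by simp
  next
    case False
    then have "W (A *v x) x / (\<nu> x)\<^sup>2 \<le> ?s"
      unfolding suprema by (intro cSUP_upper bdd_above_weak_pairing(2)[OF assms(1-3)]) simp
    then show ?thesis
      using is_norm_pos[OF assms(1) False] by (simp add: pos_divide_le_eq)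
  qed
  from log_norm_le[OF assms(1) lumer_lower_bound[OF assms(1-3) this]] have "log_norm \<nu> A \<le> ?s" .
  moreover have "?s \<le> log_norm \<nu> A"
    using pairing_le_log_norm[OF assms(1,4)]
    by (intro cSUP_least unit_sphere_nonempty[OF assms(1)]) simp
  ultimately show "log_norm \<nu> A = ?s \<and> ?s = (SUP x\<in>{x. x \<noteq> 0}. W (A *v x) x / (\<nu> x)\<^sup>2)"
    using suprema by simp
qed

end
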